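(* Let $\alpha>0$, let $h\colon\mathbb{R}^n\to\mathbb{R}$ be given by $h(\mathbf{x}):=\alpha\|\mathbf{x}\|^2$, and set $E:=\operatorname{epi}h\subseteq\mathbb{R}^{n+1}$. Let $(\mathbf{y},\eta)\in\mathbb{R}^n\times\mathbb{R}$. If $(\mathbf{y},\eta)\in E$, then $P_E(\mathbf{y},\eta)=(\mathbf{y},\eta)$. Assume now that $(\mathbf{y},\eta)\in(\mathbb{R}^n\times\mathbb{R})\smallsetminus E$, i.e., $\alpha\|\mathbf{y}\|^2>\eta$. Set $\nu:=\|\mathbf{y}\|\geq0$, $$p:=-\frac{(2\alpha\eta-1)^2}{12\alpha^2},\qquad q:=\frac{(2\alpha\eta-1)^3-27\alpha^2\nu^2}{108\alpha^3},$$ $$\Delta:=(p/3)^3+(q/2)^2=\frac{\big(27\alpha^2\nu^2-2(2\alpha\eta-1)^3\big)\nu^2}{1728\alpha^4},$$ and $$x:=\begin{cases}-\dfrac{\alpha\eta+1}{3\alpha}+\sqrt[3]{-q/2+\sqrt{\Delta}}+\sqrt[3]{-q/2-\sqrt{\Delta}},&\text{if }\Delta\geq0;\\[4mm]-\dfrac{\alpha\eta+1}{3\alpha}+\dfrac{|2\alpha\eta-1|}{3\alpha}\cos\Big(\dfrac13\arccos\dfrac{-q/2}{(-p/3)^{3/2}}\Big),&\text{if }\Delta<0.\end{cases}$$ Then $$P_E(\mathbf{y},\eta)=\Big(\frac{\mathbf{y}}{1+2\alpha x},\,\eta+x\Big).$$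
   Context: $\operatorname{epi}h=\{(\mathbf{x},\xi)\in\mathbb{R}^n\times\mathbb{R} : h(\mathbf{x})\leq\xi\}$ is the epigraph, $\|\cdot\|$ is the Euclidean norm, and $P_E$ is the projection (nearest-point mapping) onto the closed convex set $E$ with respect to the Euclidean norm on $\mathbb{R}^{n+1}$. For real $t$, $\sqrt[3]{t}$ denotes the unique real cube root of $t$ (also for negative $t$). $\arccos$ takes values in $[0,\pi]$. *)

theory Defs
  imports "HOL-Analysis.Analysis"
begin

end

theory Submission
  imports Defs
begin

text \<open>
  A point \<open>(u, \<alpha> * (norm u)\<^sup>2)\<close> of the paraboloid is the projection of every point
  \<open>(u, \<alpha> * (norm u)\<^sup>2) + x * (2 * \<alpha> * u, - 1)\<close> on the outward normal ray through it, \<open>x \<ge> 0\<close>.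
  So it suffices to find \<open>x \<ge> 0\<close> such that \<open>(y, \<eta>)\<close> lies on the ray of parameter \<open>x\<close>. The first
  components force \<open>u = y / (1 + 2 * \<alpha> * x)\<close>, and the second ones then give the scalar equation
  \<open>(\<eta> + x) * (1 + 2 * \<alpha> * x)\<^sup>2 = \<alpha> * \<nu>\<^sup>2\<close>. Outside the epigraph, any root with
  \<open>1 + 2 * \<alpha> * x > 0\<close> is automatically positive.

  With \<open>c = (2 * \<alpha> * \<eta> - 1) / (6 * \<alpha>)\<close>, \<open>k = \<nu>\<^sup>2 / (4 * \<alpha>)\<close> and the Tschirnhaus shift
  \<open>x = z - (\<alpha> * \<eta> + 1) / (3 * \<alpha>)\<close> one has \<open>1 + 2 * \<alpha> * x = 2 * \<alpha> * (z - c)\<close> and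
  \<open>\<eta> + x = z + 2 * c\<close>, so the equation becomes
  \<open>(z - c)\<^sup>2 * (z + 2 * c) = k\<close>. Expanded, this is the depressed cubic
  \<open>z ^ 3 - 3 * c\<^sup>2 * z + 2 * c ^ 3 - k = 0\<close>, whose coefficients are \<open>p = - 3 * c\<^sup>2\<close> and
  \<open>q = 2 * c ^ 3 - k\<close>. The formula for \<open>x\<close> is Cardano's formula for \<open>z\<close> if \<open>\<Delta>\<close> is
  nonnegative and Viete's trigonometric formula otherwise. What has to be checked beyond these
  classical formulas is that they select the root with \<open>z > c\<close>: for Cardano this is
  \<open>cardano_root\<close>, for Viete \<open>viete_root\<close>.
\<close>

section \<open>Projection onto the epigraph of a squared norm\<close>

text \<open>
  The hypothesis is the obtuse-angle inequality that characterises projections onto convex sets.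
  It makes the squared distance to \<open>a\<close> grow by at least \<open>(dist b z)\<^sup>2\<close> when moving from \<open>b\<close> to
  \<open>z\<close>, which gives minimality and uniqueness for an arbitrary set.
\<close>

lemma closest_point_eqI_inner:
  fixes a b :: "'a :: euclidean_space"
  assumes b: "b \<in> S" and obtuse: "\<And>z. z \<in> S \<Longrightarrow> (a - b) \<bullet> (z - b) \<le> 0"
  shows "closest_point S a = b"
proof -
  have growth: "(dist a b)\<^sup>2 + (dist b z)\<^sup>2 \<le> (dist a z)\<^sup>2" if "z \<in> S" for z
  proof -
    have "(dist a z)\<^sup>2 = (dist a b)\<^sup>2 + (dist b z)\<^sup>2 - 2 * ((a - b) \<bullet> (z - b))"
      unfolding dist_norm power2_norm_eq_inner
      by (simp add: inner_diff_left inner_diff_right inner_commute)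
    with obtuse[OF that] show ?thesis by simp
  qed
  have min: "dist a b \<le> dist a z" if "z \<in> S" for z
  proof -
    have "(dist a b)\<^sup>2 \<le> (dist a z)\<^sup>2"
      using growth[OF that] zero_le_power2[of "dist b z"] by linarith
    then show ?thesis by (rule power2_le_imp_le) simp
  qed
  show ?thesis
    unfolding closest_point_def
  proof (rule some_equality)
    show "b \<in> S \<and> (\<forall>z\<in>S. dist a b \<le> dist a z)" using b min by blast
  next
    fix z assume z: "z \<in> S \<and> (\<forall>w\<in>S. dist a z \<le> dist a w)"
    then have "dist a z = dist a b" using b min by (blast intro: order_antisym)
    moreover have "(dist a b)\<^sup>2 + (dist b z)\<^sup>2 \<le> (dist a z)\<^sup>2" using growth z by blast
    ultimately have "(dist b z)\<^sup>2 \<le> 0" by simp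
    then show "z = b" by simp
  qed
qed

text \<open>
  The vector \<open>x * (2 * \<alpha> * u, - 1)\<close> is an outward normal at the boundary point above \<open>u\<close>: by the
  tangent-plane inequality \<open>\<alpha> * (norm w)\<^sup>2 - \<alpha> * (norm u)\<^sup>2 \<ge> 2 * \<alpha> * (u \<bullet> (w - u))\<close> it makes an obtuse
  angle with every direction into the epigraph.
\<close>

lemma closest_point_epigraph_norm_sq:
  fixes u :: "'a :: euclidean_space" and \<alpha> x :: real
  assumes \<alpha>: "\<alpha> \<ge> 0" and x: "x \<ge> 0"
  shows "closest_point (epigraph UNIV (\<lambda>z. \<alpha> * (norm z)\<^sup>2))
           ((1 + 2 * \<alpha> * x) *\<^sub>R u, \<alpha> * (norm u)\<^sup>2 - x) = (u, \<alpha> * (norm u)\<^sup>2)"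
proof (rule closest_point_eqI_inner)
  show "(u, \<alpha> * (norm u)\<^sup>2) \<in> epigraph UNIV (\<lambda>z. \<alpha> * (norm z)\<^sup>2)"
    by (simp add: mem_epigraph)
next
  fix v :: "'a \<times> real"
  assume "v \<in> epigraph UNIV (\<lambda>z. \<alpha> * (norm z)\<^sup>2)"
  then obtain w \<zeta> where v: "v = (w, \<zeta>)" and \<zeta>: "\<alpha> * (norm w)\<^sup>2 \<le> \<zeta>"
    by (cases v) (simp add: mem_epigraph)
  have "\<alpha> * (norm w)\<^sup>2 = \<alpha> * (norm u)\<^sup>2 + 2 * \<alpha> * (u \<bullet> (w - u)) + \<alpha> * (norm (w - u))\<^sup>2"
    unfolding power2_norm_eq_inner
    by (simp add: inner_commute algebra_simps)
  moreover have "0 \<le> \<alpha> * (norm (w - u))\<^sup>2" using \<alpha> by simp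
  ultimately have "2 * \<alpha> * (u \<bullet> (w - u)) \<le> \<zeta> - \<alpha> * (norm u)\<^sup>2"
    using \<zeta> by linarith
  then have "x * (2 * \<alpha> * (u \<bullet> (w - u))) \<le> x * (\<zeta> - \<alpha> * (norm u)\<^sup>2)"
    using x by (rule mult_left_mono)
  moreover have "((1 + 2 * \<alpha> * x) *\<^sub>R u, \<alpha> * (norm u)\<^sup>2 - x) - (u, \<alpha> * (norm u)\<^sup>2)
      = ((2 * \<alpha> * x) *\<^sub>R u, - x)"
    by (simp add: scaleR_add_left)
  ultimately show "(((1 + 2 * \<alpha> * x) *\<^sub>R u, \<alpha> * (norm u)\<^sup>2 - x) - (u, \<alpha> * (norm u)\<^sup>2))
               \<bullet> (v - (u, \<alpha> * (norm u)\<^sup>2)) \<le> 0"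
    by (simp add: v inner_prod_def mult_ac)
qed

text \<open>
  The multiplier \<open>x\<close> is nonnegative: otherwise \<open>0 < 1 + 2 * \<alpha> * x < 1\<close>, and the equation would
  give \<open>\<eta> + x \<ge> \<alpha> * (norm y)\<^sup>2 > \<eta>\<close>.
\<close>

lemma closest_point_epigraph_norm_sq_outside:
  fixes y :: "'a :: euclidean_space" and \<alpha> \<eta> x :: real
  assumes \<alpha>: "\<alpha> > 0" and outside: "\<eta> < \<alpha> * (norm y)\<^sup>2"
    and pos: "1 + 2 * \<alpha> * x > 0"
    and root: "(\<eta> + x) * (1 + 2 * \<alpha> * x)\<^sup>2 = \<alpha> * (norm y)\<^sup>2"
  shows "closest_point (epigraph UNIV (\<lambda>z. \<alpha> * (norm z)\<^sup>2)) (y, \<eta>) = (y /\<^sub>R (1 + 2 * \<alpha> * x), \<eta> + x)"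
proof -
  let ?s = "1 + 2 * \<alpha> * x"
  let ?u = "y /\<^sub>R ?s"
  have x: "x \<ge> 0"
  proof (rule ccontr)
    assume "\<not> x \<ge> 0"
    then have "2 * \<alpha> * x < 0" using \<alpha> by (simp add: mult_pos_neg)
    then have s1: "?s\<^sup>2 \<le> 1" using pos by (simp add: power_le_one)
    have "0 \<le> (\<eta> + x) * ?s\<^sup>2" using root \<alpha> by simp
    then have "0 \<le> \<eta> + x" using pos by (simp add: zero_le_mult_iff)
    then have "\<alpha> * (norm y)\<^sup>2 \<le> \<eta> + x"
      using mult_left_mono[OF s1, of "\<eta> + x"] root by simp
    with outside \<open>\<not> x \<ge> 0\<close> show False by linarith
  qed
  have "\<alpha> * (norm ?u)\<^sup>2 = \<alpha> * (norm y)\<^sup>2 / ?s\<^sup>2"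
    using pos by (simp add: power_mult_distrib power_inverse divide_inverse)
  also have "\<dots> = \<eta> + x" using pos root by (simp add: divide_eq_eq)
  finally have u: "\<alpha> * (norm ?u)\<^sup>2 = \<eta> + x" .
  have y: "?s *\<^sub>R ?u = y" using pos by simp
  show ?thesis
    using closest_point_epigraph_norm_sq[of \<alpha> x ?u] \<alpha> x unfolding u y by simp
qed

section \<open>The distinguished root of the depressed cubic\<close>

lemma depressed_cubic_factor:
  fixes c z :: real
  shows "(z - c)\<^sup>2 * (z + 2 * c) = z ^ 3 - 3 * c\<^sup>2 * z + 2 * c ^ 3"
  by (simp add: power2_eq_square power3_eq_cube algebra_simps)

text \<open>
  Cardano's root \<open>z = u + v\<close>, with \<open>u * v = c\<^sup>2\<close>, satisfies \<open>z\<^sup>2 \<ge> 4 * u * v = (2 * c)\<^sup>2\<close>, so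
  that \<open>z \<ge> 2 * \<bar>c\<bar>\<close> or \<open>z \<le> - 2 * \<bar>c\<bar>\<close>. In the second case \<open>(z - c)\<^sup>2 * (z + 2 * c)\<close> would
  be at most zero if \<open>c \<ge> 0\<close> and negative if \<open>c < 0\<close>, whereas it equals \<open>k\<close>.
  For \<open>c = k = 0\<close> the only root is \<open>z = c\<close>, hence the hypothesis that excludes this case.
\<close>

lemma cardano_root:
  fixes c k D z :: real
  defines "q \<equiv> 2 * c ^ 3 - k"
  assumes D: "D = (q / 2)\<^sup>2 - c ^ 6" and D0: "D \<ge> 0"
    and k0: "k \<ge> 0" and k: "c \<ge> 0 \<Longrightarrow> k > 0"
    and z: "z = root 3 (- q / 2 + sqrt D) + root 3 (- q / 2 - sqrt D)"
  shows "z > c" and "(z - c)\<^sup>2 * (z + 2 * c) = k"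
proof -
  define u v where "u = root 3 (- q / 2 + sqrt D)" and "v = root 3 (- q / 2 - sqrt D)"
  have zuv: "z = u + v" by (simp add: z u_def v_def)
  have u3: "u ^ 3 = - q / 2 + sqrt D" and v3: "v ^ 3 = - q / 2 - sqrt D"
    by (simp_all add: u_def v_def odd_real_root_pow)
  have "(u * v) ^ 3 = (- q / 2 + sqrt D) * (- q / 2 - sqrt D)"
    by (simp add: power_mult_distrib u3 v3)
  also have "\<dots> = (q / 2)\<^sup>2 - (sqrt D)\<^sup>2" by (simp add: power2_eq_square algebra_simps)
  also have "\<dots> = (c\<^sup>2) ^ 3" using D0 by (simp add: D)
  finally have "root 3 ((u * v) ^ 3) = root 3 ((c\<^sup>2) ^ 3)" by simp
  moreover have "root 3 (t ^ 3) = t" for t :: real by (rule odd_real_root_power_cancel) simp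
  ultimately have uv: "u * v = c\<^sup>2" by (simp only:)
  have "z ^ 3 = u ^ 3 + v ^ 3 + 3 * (u * v) * z"
    by (simp add: zuv power3_eq_cube algebra_simps)
  then have "z ^ 3 = 3 * c\<^sup>2 * z - q" unfolding u3 v3 uv by simp
  then show eq: "(z - c)\<^sup>2 * (z + 2 * c) = k"
    by (simp only: depressed_cubic_factor) (simp add: q_def)
  have "z\<^sup>2 - 4 * (u * v) = (u - v)\<^sup>2"
    by (simp add: zuv power2_eq_square algebra_simps)
  moreover have "(u - v)\<^sup>2 \<ge> 0" by simp
  ultimately have "4 * c\<^sup>2 \<le> z\<^sup>2" unfolding uv by linarith
  then have "(2 * c)\<^sup>2 \<le> z\<^sup>2" by (simp add: power_mult_distrib)
  then have abs: "\<bar>2 * c\<bar> \<le> \<bar>z\<bar>" by (simp only: abs_le_square_iff)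
  show "z > c"
  proof (cases "c \<ge> 0")
    case True
    then have "0 < (z - c)\<^sup>2 * (z + 2 * c)" using k eq by simp
    then have "z \<noteq> c" and "z + 2 * c > 0" by (auto simp: zero_less_mult_iff)
    with abs True show ?thesis by linarith
  next
    case False
    show ?thesis
    proof (rule ccontr)
      assume "\<not> z > c"
      with abs False have "z + 2 * c < 0" "z - c \<noteq> 0" by linarith+
      then have "(z - c)\<^sup>2 * (z + 2 * c) < 0" by (intro mult_pos_neg) simp_all
      with eq k0 show False by simp
    qed
  qed
qed

text \<open>
  The triple-angle formula turns \<open>z = 2 * c * cos \<theta>\<close> into a root. As \<open>\<theta> \<le> pi / 3\<close>, it satisfies
  \<open>z \<ge> c\<close>, and \<open>z = c\<close> is excluded by \<open>k > 0\<close>.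
\<close>

lemma viete_root:
  fixes c k z :: real
  defines "q \<equiv> 2 * c ^ 3 - k"
  assumes c: "c > 0" and k: "k > 0" and D: "(q / 2)\<^sup>2 - c ^ 6 < 0"
    and z: "z = 2 * c * cos (1 / 3 * arccos ((- q / 2) / c ^ 3))"
  shows "z > c" and "(z - c)\<^sup>2 * (z + 2 * c) = k"
proof -
  define w where "w = (- q / 2) / c ^ 3"
  define \<theta> where "\<theta> = 1 / 3 * arccos w"
  have z\<theta>: "z = 2 * c * cos \<theta>" by (simp only: z w_def \<theta>_def)
  have c3: "c ^ 3 > 0" using c by simp
  have "\<bar>q / 2\<bar>\<^sup>2 < (c ^ 3)\<^sup>2" using D unfolding power2_abs by simp
  then have "\<bar>q / 2\<bar> < c ^ 3" using c3 by (rule power2_less_imp_less[OF _ less_imp_le])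
  then have w: "- 1 \<le> w" "w \<le> 1"
    using c3 by (auto simp: w_def field_simps abs_less_iff)
  have "0 \<le> \<theta>" "\<theta> \<le> pi / 3"
    using arccos_lbound[OF w] arccos_ubound[OF w] by (simp_all add: \<theta>_def)
  then have "cos (pi / 3) \<le> cos \<theta>" by (intro cos_monotone_0_pi_le) simp_all
  then have "1 / 2 \<le> cos \<theta>" by (simp add: cos_60)
  from mult_left_mono[OF this, of "2 * c"] have ge: "z \<ge> c" using c by (simp add: z\<theta>)
  have "w = cos (3 * \<theta>)" using w by (simp add: \<theta>_def cos_arccos)
  also have "\<dots> = 4 * cos \<theta> ^ 3 - 3 * cos \<theta>" by (rule cos_treble_cos)
  finally have w_cubic: "w = 4 * cos \<theta> ^ 3 - 3 * cos \<theta>" .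
  have "2 * c ^ 3 * w = z ^ 3 - 3 * c\<^sup>2 * z"
    unfolding w_cubic by (simp add: z\<theta> power2_eq_square power3_eq_cube algebra_simps)
  moreover have "2 * c ^ 3 * w = - q" using c by (simp add: w_def)
  ultimately show eq: "(z - c)\<^sup>2 * (z + 2 * c) = k"
    unfolding depressed_cubic_factor by (simp add: q_def)
  from eq k have "z \<noteq> c" by auto
  with ge show "z > c" by simp
qed

section \<open>The projection formula\<close>

theorem theorem6p1:
  fixes \<alpha> \<eta> \<nu> p q \<Delta> x :: real
    and y :: "real ^ 'n"
    and h :: "real ^ 'n \<Rightarrow> real"
    and E :: "((real ^ 'n) \<times> real) set"
  assumes "\<alpha> > 0"
    and "h = (\<lambda>z. \<alpha> * (norm z)\<^sup>2)"
    and "E = epigraph UNIV h"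
    and "\<nu> = norm y"
    and "p = - ((2 * \<alpha> * \<eta> - 1)\<^sup>2 / (12 * \<alpha>\<^sup>2))"
    and "q = ((2 * \<alpha> * \<eta> - 1) ^ 3 - 27 * \<alpha>\<^sup>2 * \<nu>\<^sup>2) / (108 * \<alpha> ^ 3)"
    and "\<Delta> = (p / 3) ^ 3 + (q / 2)\<^sup>2"
    and "x = (if \<Delta> \<ge> 0
              then - ((\<alpha> * \<eta> + 1) / (3 * \<alpha>))
                   + root 3 (- q / 2 + sqrt \<Delta>) + root 3 (- q / 2 - sqrt \<Delta>)
              else - ((\<alpha> * \<eta> + 1) / (3 * \<alpha>))
                   + \<bar>2 * \<alpha> * \<eta> - 1\<bar> / (3 * \<alpha>)
                     * cos (1 / 3 * arccos ((- q / 2) / (- p / 3) powr (3 / 2))))"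
  shows "((y, \<eta>) \<in> E \<longrightarrow> closest_point E (y, \<eta>) = (y, \<eta>)) \<and>
         ((y, \<eta>) \<notin> E \<longrightarrow>
            \<Delta> = (27 * \<alpha>\<^sup>2 * \<nu>\<^sup>2 - 2 * (2 * \<alpha> * \<eta> - 1) ^ 3) * \<nu>\<^sup>2 / (1728 * \<alpha> ^ 4) \<and>
            1 + 2 * \<alpha> * x \<noteq> 0 \<and>
            closest_point E (y, \<eta>) = (y /\<^sub>R (1 + 2 * \<alpha> * x), \<eta> + x))"
proof -
  define c where "c = (2 * \<alpha> * \<eta> - 1) / (6 * \<alpha>)"
  define k where "k = \<nu>\<^sup>2 / (4 * \<alpha>)"
  define z where "z = x + (\<alpha> * \<eta> + 1) / (3 * \<alpha>)"
  note \<alpha> = \<open>\<alpha> > 0\<close>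
  have t: "2 * \<alpha> * \<eta> - 1 = 6 * \<alpha> * c" and k\<nu>: "\<nu>\<^sup>2 = 4 * \<alpha> * k"
    using \<alpha> by (simp_all add: c_def k_def)
  have p: "p / 3 = - c\<^sup>2"
    using \<alpha> unfolding assms(5) t by (simp add: power2_eq_square field_simps)
  have q: "q = 2 * c ^ 3 - k"
    using \<alpha> unfolding assms(6) t k\<nu> by (simp add: power2_eq_square power3_eq_cube field_simps)
  have \<Delta>: "\<Delta> = (q / 2)\<^sup>2 - c ^ 6"
    unfolding assms(7) p by simp
  have \<Delta>_factored: "\<Delta> = k * (k - 4 * c ^ 3) / 4"
    unfolding \<Delta> q by (simp add: eval_nat_numeral field_simps)
  have \<Delta>_formula: "\<Delta> = (27 * \<alpha>\<^sup>2 * \<nu>\<^sup>2 - 2 * (2 * \<alpha> * \<eta> - 1) ^ 3) * \<nu>\<^sup>2 / (1728 * \<alpha> ^ 4)"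
  proof -
    have "(27 * \<alpha>\<^sup>2 * \<nu>\<^sup>2 - 2 * (2 * \<alpha> * \<eta> - 1) ^ 3) * \<nu>\<^sup>2 = 1728 * \<alpha> ^ 4 * \<Delta>"
      unfolding \<Delta>_factored t k\<nu> by (simp add: eval_nat_numeral algebra_simps)
    then show ?thesis using \<alpha> by simp
  qed
  have k0: "k \<ge> 0" using \<alpha> by (simp add: k_def)
  have E: "E = epigraph UNIV (\<lambda>z. \<alpha> * (norm z)\<^sup>2)" by (simp add: assms(2,3))
  have inside: "closest_point E (y, \<eta>) = (y, \<eta>)" if "(y, \<eta>) \<in> E"
    using that by (rule closest_point_self)
  have outside: "1 + 2 * \<alpha> * x \<noteq> 0 \<and>
      closest_point E (y, \<eta>) = (y /\<^sub>R (1 + 2 * \<alpha> * x), \<eta> + x)" if "(y, \<eta>) \<notin> E"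
  proof -
    have out: "\<eta> < \<alpha> * (norm y)\<^sup>2" using that by (simp add: E mem_epigraph)
    (* For c >= 0 the height \<eta> is positive, so the point (y, \<eta>) outside E is off the axis. *)
    have kpos: "k > 0" if "c \<ge> 0"
    proof -
      have "2 * \<alpha> * \<eta> \<ge> 1" using that \<alpha> by (simp add: c_def zero_le_divide_iff)
      then have "2 * \<alpha> * \<eta> > 0" by linarith
      then have "\<eta> > 0" using \<alpha> by (simp add: zero_less_mult_iff)
      with out have "\<nu> \<noteq> 0" by (auto simp: assms(4))
      then show ?thesis using \<alpha> by (simp add: k_def)
    qed
    have "z > c \<and> (z - c)\<^sup>2 * (z + 2 * c) = k"
    proof (cases "\<Delta> \<ge> 0")
      case True
      then have "z = root 3 (- q / 2 + sqrt \<Delta>) + root 3 (- q / 2 - sqrt \<Delta>)"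
        by (simp add: z_def assms(8))
      then show ?thesis using cardano_root[of \<Delta> c k z] \<Delta> True k0 kpos by (simp add: q)
    next
      case False
      then have "k * (k - 4 * c ^ 3) < 0" by (simp add: \<Delta>_factored)
      with k0 have "k > 0" "k < 4 * c ^ 3" by (auto simp: mult_less_0_iff)
      then have "c ^ 3 > 0" by linarith
      then have c: "c > 0" by (simp add: zero_less_power_eq)
      have powr: "(- p / 3) powr (3 / 2) = c ^ 3"
      proof -
        have "- p / 3 = c powr 2" using p c by simp
        then have "(- p / 3) powr (3 / 2) = c powr 3" by (simp add: powr_powr)
        then show ?thesis using c by simp
      qed
      have abs: "\<bar>2 * \<alpha> * \<eta> - 1\<bar> / (3 * \<alpha>) = 2 * c"
        using c \<alpha> unfolding t by simp
      have "z = 2 * c * cos (1 / 3 * arccos ((- q / 2) / c ^ 3))"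
        using False unfolding z_def assms(8) powr abs by simp
      then show ?thesis using viete_root[of c k z] c \<open>k > 0\<close> \<Delta> False by (simp add: q)
    qed
    then have zc: "z > c" and root: "(z - c)\<^sup>2 * (z + 2 * c) = k" by simp_all
    have s: "1 + 2 * \<alpha> * x = 2 * \<alpha> * (z - c)" and \<xi>: "\<eta> + x = z + 2 * c"
      using \<alpha> by (simp_all add: z_def c_def field_simps)
    have pos: "1 + 2 * \<alpha> * x > 0" using \<alpha> zc by (simp add: s)
    have "(\<eta> + x) * (1 + 2 * \<alpha> * x)\<^sup>2 = 4 * \<alpha>\<^sup>2 * ((z - c)\<^sup>2 * (z + 2 * c))"
      unfolding s \<xi> by (simp add: power_mult_distrib)
    also have "\<dots> = \<alpha> * (norm y)\<^sup>2"
      unfolding root assms(4)[symmetric] k\<nu> by (simp add: power2_eq_square)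
    finally show ?thesis
      using closest_point_epigraph_norm_sq_outside[OF \<alpha> out pos] pos by (simp add: E)
  qed
  show ?thesis using inside outside \<Delta>_formula by blast
qed

end
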